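(* Let $p\in(0,1)$ and let $(X_t,\Delta_t)_{t\in\mathbb{Z}_{\ge0}}$ be the Markov chain on $\mathbb{Z}\times\{-1,+1\}$ with transitions $$\mathrm{Prob}(X_{t+1}=X_t+\Delta_t;\ \Delta_{t+1}=\Delta_t)=p,\qquad \mathrm{Prob}(X_{t+1}=X_t;\ \Delta_{t+1}=-\Delta_t)=1-p,$$ and initial distribution $\mathrm{Prob}(X_0=0;\Delta_0=+1)=\mathrm{Prob}(X_0=0;\Delta_0=-1)=\frac12$. Let $D_{X_t}$ be the variance of $X_t$. Then the diffusion coefficient $\mathcal{D}_c(p)=\lim_{t\to\infty}\dfrac{D_{X_t}}{2t}$ exists and equals $$\mathcal{D}_c(p)=\frac12\,\frac{p}{1-p}.$$
   Context: The chain describes the projection on one axis of the movement of a single particle in the two-dimensional cellular automaton with the Margolus neighbourhood ($2\times2$ blocks of alternating even/odd partitions, each rotated independently by $90^\circ$ clockwise or counterclockwise with probability $p$ for each outcome; there physically $0<p\le\frac12$). $X_t$ is the coordinate of the particle and $\Delta_t$ the direction of its possible movement at time step $t$. The diffusion coefficient is taken in units where the cell side length and the time step both equal 1, and is defined as the limit of $D_{X_t}/(2t)$. *)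

theory Defs
  imports "HOL-Probability.Probability"
begin

text \<open>
  A discrete-time Markov chain on the countable state space \<open>S\<close>, realised on an arbitrary
  probability space \<open>M\<close>, with initial distribution \<open>\<mu>\<close> and time-homogeneous transition
  probabilities \<open>K\<close>.
\<close>
definition markov_chain ::
    "'a measure \<Rightarrow> 's set \<Rightarrow> 's pmf \<Rightarrow> ('s \<Rightarrow> 's pmf) \<Rightarrow> (nat \<Rightarrow> 'a \<Rightarrow> 's) \<Rightarrow> bool" where
  "markov_chain M S \<mu> K Y \<longleftrightarrow>
     prob_space M \<and> countable S \<and>
     (\<forall>t. Y t \<in> measurable M (count_space S)) \<and>
     (\<forall>y\<in>S. \<P>(\<omega> in M. Y 0 \<omega> = y) = pmf \<mu> y) \<and>
     (\<forall>t h. \<forall>y\<in>S. \<P>(\<omega> in M. \<forall>i\<le>t. Y i \<omega> = h i) > 0 \<longrightarrow>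
        \<P>(\<omega> in M. Y (Suc t) \<omega> = y \<bar> \<forall>i\<le>t. Y i \<omega> = h i) = pmf (K (h t)) y)"

definition particle_states :: "(int \<times> int) set" where
  "particle_states = UNIV \<times> {-1, 1}"

definition particle_init :: "(int \<times> int) pmf" where
  "particle_init = pmf_of_set {(0, 1), (0, -1)}"

definition particle_step :: "real \<Rightarrow> int \<times> int \<Rightarrow> (int \<times> int) pmf" where
  "particle_step p = (\<lambda>(x, d).
     map_pmf (\<lambda>b. if b then (x + d, d) else (x, - d)) (bernoulli_pmf p))"

definition diffusion_ratio :: "'a measure \<Rightarrow> (nat \<Rightarrow> 'a \<Rightarrow> int) \<Rightarrow> nat \<Rightarrow> real" where
  "diffusion_ratio M X t = prob_space.variance M (\<lambda>\<omega>. real_of_int (X t \<omega>)) / (2 * real t)"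

text \<open>As \<open>lim\<close> is unspecified for divergent sequences, this is meaningful only together with
  \<open>convergent (diffusion_ratio M X)\<close>.\<close>
definition diffusion_coefficient :: "'a measure \<Rightarrow> (nat \<Rightarrow> 'a \<Rightarrow> int) \<Rightarrow> real" where
  "diffusion_coefficient M X = lim (diffusion_ratio M X)"

end

theory Submission
  imports Defs
begin

text \<open>
  The displacement \<open>X\<close> is the time integral of a persistent velocity. Write \<open>q = 2 * p - 1\<close> and
  \<open>c = p / (1 - p)\<close>. One step multiplies \<open>E \<Delta>\<close> by \<open>q\<close>, so that the symmetric start keeps both
  \<open>E \<Delta>\<close> and \<open>E X\<close> equal to \<open>0\<close>. As \<open>\<Delta>\<^sup>2 = 1\<close>, the moments \<open>b t = E (X t * \<Delta> t)\<close> and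
  \<open>a t = E (X t)\<^sup>2\<close> satisfy the closed linear system
  \<open>b (t + 1) = q * b t + p\<close> and \<open>a (t + 1) = a t + p * (2 * b t + 1)\<close>.
  Since \<open>\<bar>q\<bar> < 1\<close>, the correlation \<open>b t = c / 2 * (1 - q ^ t)\<close> saturates, and then \<open>a\<close> grows
  linearly:
  \<open>a t = c * t - c\<^sup>2 / 2 * (1 - q ^ t)\<close>. Dividing by \<open>2 * t\<close> leaves \<open>c / 2\<close> in the limit.

  The moment equations need the one-dimensional laws of the chain only. However, the Markov
  property is given for conditioning on the whole past, so \<open>markov_chain_forget\<close> first discards
  the past, and \<open>markov_chain_law\<close> identifies the law at time \<open>t\<close> with the \<open>t\<close>-fold application
  of the kernel to the initial distribution. That law has finite support, hence all moments
  exist and the recursion is a finite computation.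
\<close>

section \<open>One-dimensional laws of a Markov chain\<close>

primrec chain_law :: "'s pmf \<Rightarrow> ('s \<Rightarrow> 's pmf) \<Rightarrow> nat \<Rightarrow> 's pmf" where
  "chain_law \<mu> K 0 = \<mu>"
| "chain_law \<mu> K (Suc t) = bind_pmf (chain_law \<mu> K t) K"

lemma markov_chain_measurable:
  assumes "markov_chain M S \<mu> K Y"
  shows "Y t \<in> measurable M (count_space UNIV)"
proof -
  have Y: "Y t \<in> measurable M (count_space S)"
    using assms by (simp add: markov_chain_def)
  have "Y t -` A \<inter> space M \<in> sets M" for A
  proof -
    have "Y t -` A \<inter> space M = Y t -` (A \<inter> S) \<inter> space M"
      using measurable_space[OF Y] by auto
    then show ?thesis
      using measurable_sets[OF Y, of "A \<inter> S"] by simp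
  qed
  then show ?thesis by (auto simp: measurable_def)
qed

lemma markov_chain_event:
  assumes "markov_chain M S \<mu> K Y"
  shows "{\<omega> \<in> space M. Y t \<omega> = y} \<in> sets M"
    and "{\<omega> \<in> space M. \<forall>i\<in>{k..t}. Y i \<omega> = h i} \<in> sets M"
    and "{\<omega> \<in> space M. Y (Suc t) \<omega> = y \<and> (\<forall>i\<in>{k..t}. Y i \<omega> = h i)} \<in> sets M"
  using markov_chain_measurable[OF assms, measurable] by measurable

lemma markov_chain_decompose:
  assumes mc: "markov_chain M S \<mu> K Y"
    and P: "{\<omega> \<in> space M. P \<omega>} \<in> sets M"
  shows "emeasure M {\<omega> \<in> space M. P \<omega>} =
    (\<integral>\<^sup>+s. emeasure M {\<omega> \<in> space M. P \<omega> \<and> Y k \<omega> = s} \<partial>count_space S)"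
proof -
  note [measurable] = markov_chain_measurable[OF mc] P
  have S: "countable S" and Y: "Y k \<in> measurable M (count_space S)"
    using mc by (auto simp: markov_chain_def)
  have "{\<omega> \<in> space M. P \<omega>} = (\<Union>s\<in>S. {\<omega> \<in> space M. P \<omega> \<and> Y k \<omega> = s})"
    using measurable_space[OF Y] by auto
  moreover have "emeasure M (\<Union>s\<in>S. {\<omega> \<in> space M. P \<omega> \<and> Y k \<omega> = s}) =
    (\<integral>\<^sup>+s. emeasure M {\<omega> \<in> space M. P \<omega> \<and> Y k \<omega> = s} \<partial>count_space S)"
    using S by (intro emeasure_UN_countable) (auto simp: disjoint_family_on_def)
  ultimately show ?thesis by simp
qed

text \<open>
  The coordinates of the past are summed out one at a time, oldest first. At each stage the
  last state \<open>h t\<close> is untouched, so the transition probability is a constant factor of the sum.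
  This needs sums over \<open>S\<close> only, and no space of trajectories.
\<close>
lemma markov_chain_forget:
  assumes mc: "markov_chain M S \<mu> K Y" and y: "y \<in> S" and "k \<le> t"
  shows "emeasure M {\<omega> \<in> space M. Y (Suc t) \<omega> = y \<and> (\<forall>i\<in>{k..t}. Y i \<omega> = h i)} =
    emeasure M {\<omega> \<in> space M. \<forall>i\<in>{k..t}. Y i \<omega> = h i} * ennreal (pmf (K (h t)) y)"
  using \<open>k \<le> t\<close>
proof (induction k arbitrary: h)
  case 0
  interpret prob_space M using mc by (simp add: markov_chain_def)
  let ?H = "{\<omega> \<in> space M. \<forall>i\<in>{0..t}. Y i \<omega> = h i}"
  let ?J = "{\<omega> \<in> space M. Y (Suc t) \<omega> = y \<and> (\<forall>i\<in>{0..t}. Y i \<omega> = h i)}"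
  have "prob ?J = prob ?H * pmf (K (h t)) y"
  proof (cases "prob ?H > 0")
    case True
    have "\<P>(\<omega> in M. Y (Suc t) \<omega> = y \<bar> \<forall>i\<le>t. Y i \<omega> = h i) = pmf (K (h t)) y"
      using mc y True by (simp add: markov_chain_def Ball_def)
    then show ?thesis
      using True by (simp add: cond_prob_def Ball_def field_simps)
  next
    case False
    moreover have "prob ?J \<le> prob ?H"
      by (intro finite_measure_mono markov_chain_event[OF mc]) auto
    ultimately show ?thesis
      using measure_nonneg[of M ?J] measure_nonneg[of M ?H] by (simp add: not_less)
  qed
  then show ?case by (simp add: emeasure_eq_measure ennreal_mult)
next
  case (Suc k)
  have split: "(\<forall>i\<in>{Suc k..t}. Y i \<omega> = h i) \<and> Y k \<omega> = s \<longleftrightarrow>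
      (\<forall>i\<in>{k..t}. Y i \<omega> = (h(k := s)) i)" for \<omega> s
  proof -
    have "{k..t} = insert k {Suc k..t}" using Suc.prems by auto
    then show ?thesis by auto
  qed
  have IH: "emeasure M {\<omega> \<in> space M. Y (Suc t) \<omega> = y \<and> (\<forall>i\<in>{k..t}. Y i \<omega> = (h(k := s)) i)} =
      emeasure M {\<omega> \<in> space M. \<forall>i\<in>{k..t}. Y i \<omega> = (h(k := s)) i} * ennreal (pmf (K (h t)) y)" for s
    using Suc.IH[of "h(k := s)"] Suc.prems by simp
  have "emeasure M {\<omega> \<in> space M. Y (Suc t) \<omega> = y \<and> (\<forall>i\<in>{Suc k..t}. Y i \<omega> = h i)} =
      (\<integral>\<^sup>+s. emeasure M {\<omega> \<in> space M. \<forall>i\<in>{k..t}. Y i \<omega> = (h(k := s)) i} *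
        ennreal (pmf (K (h t)) y) \<partial>count_space S)"
    by (subst markov_chain_decompose[OF mc markov_chain_event(3)[OF mc], where k = k])
      (simp only: conj_assoc split IH)
  also have "\<dots> = (\<integral>\<^sup>+s. emeasure M {\<omega> \<in> space M. \<forall>i\<in>{k..t}. Y i \<omega> = (h(k := s)) i}
      \<partial>count_space S) * ennreal (pmf (K (h t)) y)"
    by (rule nn_integral_multc) simp
  also have "(\<integral>\<^sup>+s. emeasure M {\<omega> \<in> space M. \<forall>i\<in>{k..t}. Y i \<omega> = (h(k := s)) i} \<partial>count_space S) =
      emeasure M {\<omega> \<in> space M. \<forall>i\<in>{Suc k..t}. Y i \<omega> = h i}"
    by (subst markov_chain_decompose[OF mc markov_chain_event(2)[OF mc], where k = k])
      (simp only: split)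
  finally show ?case .
qed

lemma set_chain_law:
  assumes "set_pmf \<mu> \<subseteq> S" and "\<And>x. x \<in> S \<Longrightarrow> set_pmf (K x) \<subseteq> S"
  shows "set_pmf (chain_law \<mu> K t) \<subseteq> S"
  using assms by (induction t) fastforce+

lemma markov_chain_law:
  assumes mc: "markov_chain M S \<mu> K Y"
    and \<mu>: "set_pmf \<mu> \<subseteq> S" and K: "\<And>x. x \<in> S \<Longrightarrow> set_pmf (K x) \<subseteq> S"
  shows "distr M (count_space UNIV) (Y t) = measure_pmf (chain_law \<mu> K t)"
proof -
  interpret prob_space M using mc by (simp add: markov_chain_def)
  note Y = markov_chain_measurable[OF mc]
  have sub: "set_pmf (chain_law \<mu> K t) \<subseteq> S" for t by (rule set_chain_law[OF \<mu> K])
  have law: "emeasure M {\<omega> \<in> space M. Y t \<omega> = y} = ennreal (pmf (chain_law \<mu> K t) y)" if "y \<in> S" for y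
    using that
  proof (induction t arbitrary: y)
    case 0
    then show ?case using mc by (simp add: markov_chain_def emeasure_eq_measure)
  next
    case (Suc t)
    have "emeasure M {\<omega> \<in> space M. Y (Suc t) \<omega> = y} =
        (\<integral>\<^sup>+s. emeasure M {\<omega> \<in> space M. Y (Suc t) \<omega> = y \<and> Y t \<omega> = s} \<partial>count_space S)"
      by (rule markov_chain_decompose[OF mc markov_chain_event(1)[OF mc]])
    also have "\<dots> = (\<integral>\<^sup>+s. emeasure M {\<omega> \<in> space M. Y t \<omega> = s} * ennreal (pmf (K s) y) \<partial>count_space S)"
      using markov_chain_forget[OF mc Suc.prems order_refl, where h = "\<lambda>_. s" for s] by simp
    also have "\<dots> = (\<integral>\<^sup>+s. ennreal (pmf (chain_law \<mu> K t) s) * ennreal (pmf (K s) y) \<partial>count_space S)"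
      by (rule nn_integral_cong) (simp add: Suc.IH)
    also have "\<dots> = (\<integral>\<^sup>+s. ennreal (pmf (chain_law \<mu> K t) s) * ennreal (pmf (K s) y) \<partial>count_space UNIV)"
      using sub[of t]
      by (intro nn_integral_count_space_eq) (auto simp: set_pmf_iff)
    also have "\<dots> = ennreal (pmf (chain_law \<mu> K (Suc t)) y)"
      by (simp add: ennreal_pmf_bind nn_integral_measure_pmf)
    finally show ?case .
  qed
  have S: "countable S" and YS: "Y t \<in> measurable M (count_space S)"
    using mc by (auto simp: markov_chain_def)
  show ?thesis
  proof (rule measure_eqI_countable_AE[where \<Omega> = S])
    show "AE x in distr M (count_space UNIV) (Y t). x \<in> S"
      using measurable_space[OF YS] by (subst AE_distr_iff[OF Y]) auto
    show "AE x in measure_pmf (chain_law \<mu> K t). x \<in> S"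
      using sub by (auto simp: AE_measure_pmf_iff)
    show "emeasure (distr M (count_space UNIV) (Y t)) {y} =
        emeasure (measure_pmf (chain_law \<mu> K t)) {y}" if "y \<in> S" for y
    proof -
      have "Y t -` {y} \<inter> space M = {\<omega> \<in> space M. Y t \<omega> = y}" by auto
      then show ?thesis
        using law[OF that] by (simp add: emeasure_distr[OF Y] emeasure_pmf_single)
    qed
  qed (use S in auto)
qed

lemma markov_chain_expectation:
  fixes f :: "'s \<Rightarrow> real"
  assumes mc: "markov_chain M S \<mu> K Y"
    and \<mu>: "set_pmf \<mu> \<subseteq> S" and K: "\<And>x. x \<in> S \<Longrightarrow> set_pmf (K x) \<subseteq> S"
  shows "(\<integral>\<omega>. f (Y t \<omega>) \<partial>M) = measure_pmf.expectation (chain_law \<mu> K t) f"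
  using integral_distr[OF markov_chain_measurable[OF mc], of f t]
  by (simp add: markov_chain_law[OF mc \<mu> K])

section \<open>Moments of the persistent walk\<close>

abbreviation particle_law :: "real \<Rightarrow> nat \<Rightarrow> (int \<times> int) pmf" where
  "particle_law p \<equiv> chain_law particle_init (particle_step p)"

lemma set_particle_init: "set_pmf particle_init = {(0, 1), (0, -1)}"
  by (simp add: particle_init_def)

lemma set_particle_step: "set_pmf (particle_step p (x, d)) \<subseteq> {(x + d, d), (x, - d)}"
  by (auto simp: particle_step_def)

lemma set_particle_law: "set_pmf (particle_law p t) \<subseteq> {- int t..int t} \<times> {-1, 1}"
proof (induction t)
  case 0
  then show ?case by (auto simp: set_particle_init)
next
  case (Suc t)
  show ?case
  proof
    fix z assume "z \<in> set_pmf (particle_law p (Suc t))"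
    then obtain x d where xd: "(x, d) \<in> set_pmf (particle_law p t)"
      and z: "z \<in> set_pmf (particle_step p (x, d))" by auto
    show "z \<in> {- int (Suc t)..int (Suc t)} \<times> {-1, 1}"
      using subsetD[OF Suc.IH xd] subsetD[OF set_particle_step z] by auto
  qed
qed

lemma finite_particle_law: "finite (set_pmf (particle_law p t))"
  by (rule finite_subset[OF set_particle_law]) simp

lemma expectation_particle_law_0:
  fixes f :: "int \<times> int \<Rightarrow> real"
  shows "measure_pmf.expectation (particle_law p 0) f = (f (0, 1) + f (0, -1)) / 2"
  by (simp add: particle_init_def integral_pmf_of_set)

lemma expectation_particle_law_Suc:
  fixes f :: "int \<times> int \<Rightarrow> real"
  assumes "0 \<le> p" and "p \<le> 1"
  shows "measure_pmf.expectation (particle_law p (Suc t)) f =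
    measure_pmf.expectation (particle_law p t)
      (\<lambda>(x, d). p * f (x + d, d) + (1 - p) * f (x, - d))"
proof -
  let ?A = "set_pmf (particle_law p t)"
  have step: "measure_pmf.expectation (particle_step p z) f =
      (\<lambda>(x, d). p * f (x + d, d) + (1 - p) * f (x, - d)) z" for z
    using assms by (cases z) (simp add: particle_step_def)
  have fin: "finite (set_pmf (particle_step p z))" for z
    by (cases z) (auto intro: finite_subset[OF set_particle_step])
  have "measure_pmf.expectation (particle_law p (Suc t)) f =
      (\<Sum>z\<in>?A. pmf (particle_law p t) z *\<^sub>R measure_pmf.expectation (particle_step p z) f)"
    unfolding chain_law.simps
    by (rule pmf_expectation_bind) (simp_all add: finite_particle_law fin)
  also have "\<dots> = measure_pmf.expectation (particle_law p t)
      (\<lambda>(x, d). p * f (x + d, d) + (1 - p) * f (x, - d))"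
    unfolding step by (rule integral_measure_pmf[symmetric]) (auto simp: finite_particle_law)
  finally show ?thesis .
qed

lemma integrable_particle_law [simp]:
  fixes f :: "int \<times> int \<Rightarrow> real"
  shows "integrable (measure_pmf (particle_law p t)) f"
  by (rule integrable_measure_pmf_finite[OF finite_particle_law])

lemma expectation_direction:
  assumes "0 \<le> p" and "p \<le> 1"
  shows "measure_pmf.expectation (particle_law p t) (\<lambda>(x, d). real_of_int d) = 0"
proof (induction t)
  case 0
  show ?case by (subst expectation_particle_law_0) simp
next
  case (Suc t)
  have "measure_pmf.expectation (particle_law p (Suc t)) (\<lambda>(x, d). real_of_int d) =
      measure_pmf.expectation (particle_law p t) (\<lambda>z. (2 * p - 1) * (\<lambda>(x, d). real_of_int d) z)"
    unfolding expectation_particle_law_Suc[OF assms]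
    by (intro arg_cong[where f = "measure_pmf.expectation _"] ext) (auto simp: algebra_simps)
  then show ?case using Suc.IH by simp
qed

lemma expectation_position:
  assumes "0 \<le> p" and "p \<le> 1"
  shows "measure_pmf.expectation (particle_law p t) (\<lambda>(x, d). real_of_int x) = 0"
proof (induction t)
  case 0
  show ?case by (subst expectation_particle_law_0) simp
next
  case (Suc t)
  have "measure_pmf.expectation (particle_law p (Suc t)) (\<lambda>(x, d). real_of_int x) =
      measure_pmf.expectation (particle_law p t)
        (\<lambda>z. (\<lambda>(x, d). real_of_int x) z + p * (\<lambda>(x, d). real_of_int d) z)"
    unfolding expectation_particle_law_Suc[OF assms]
    by (intro arg_cong[where f = "measure_pmf.expectation _"] ext) (auto simp: algebra_simps)
  then show ?case using Suc.IH expectation_direction[OF assms, of t] by simp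
qed

text \<open>
  The correlation \<open>b\<close> obeys the affine recursion \<open>b' = (2 * p - 1) * b + p\<close>, whose fixed point is
  \<open>p / (2 * (1 - p))\<close>; the distance from it is multiplied by \<open>2 * p - 1\<close> at each step.
\<close>
lemma expectation_position_direction:
  assumes "0 \<le> p" and "p < 1"
  shows "measure_pmf.expectation (particle_law p t) (\<lambda>(x, d). real_of_int x * real_of_int d) =
    p / (1 - p) / 2 * (1 - (2 * p - 1) ^ t)"
proof (induction t)
  case 0
  show ?case by (subst expectation_particle_law_0) simp
next
  case (Suc t)
  let ?B = "\<lambda>(x, d). real_of_int x * real_of_int d"
  have p: "0 \<le> p" "p \<le> 1" using assms by auto
  have "measure_pmf.expectation (particle_law p (Suc t)) ?B =
      measure_pmf.expectation (particle_law p t) (\<lambda>z. (2 * p - 1) * ?B z + p)"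
    unfolding expectation_particle_law_Suc[OF p]
  proof (intro integral_cong_AE)
    show "AE z in measure_pmf (particle_law p t).
        (case z of (x, d) \<Rightarrow> p * ?B (x + d, d) + (1 - p) * ?B (x, - d)) = (2 * p - 1) * ?B z + p"
      using set_particle_law[of p t] by (auto simp: AE_measure_pmf_iff algebra_simps)
  qed auto
  also have "\<dots> = (2 * p - 1) * (p / (1 - p) / 2 * (1 - (2 * p - 1) ^ t)) + p"
    using Suc.IH by simp
  also have "\<dots> = p / (1 - p) / 2 * (1 - (2 * p - 1) ^ Suc t)"
    using assms(2) by (simp add: divide_simps) (simp add: algebra_simps)
  finally show ?case .
qed

lemma expectation_position_square:
  assumes "0 \<le> p" and "p < 1"
  shows "measure_pmf.expectation (particle_law p t) (\<lambda>(x, d). (real_of_int x)\<^sup>2) =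
    p / (1 - p) * real t - (p / (1 - p))\<^sup>2 / 2 * (1 - (2 * p - 1) ^ t)"
proof (induction t)
  case 0
  show ?case by (subst expectation_particle_law_0) simp
next
  case (Suc t)
  let ?A = "\<lambda>(x, d). (real_of_int x)\<^sup>2"
  let ?B = "\<lambda>(x, d). real_of_int x * real_of_int d"
  have p: "0 \<le> p" "p \<le> 1" using assms by auto
  have "measure_pmf.expectation (particle_law p (Suc t)) ?A =
      measure_pmf.expectation (particle_law p t) (\<lambda>z. ?A z + (2 * p * ?B z + p))"
    unfolding expectation_particle_law_Suc[OF p]
  proof (intro integral_cong_AE)
    show "AE z in measure_pmf (particle_law p t).
        (case z of (x, d) \<Rightarrow> p * ?A (x + d, d) + (1 - p) * ?A (x, - d)) = ?A z + (2 * p * ?B z + p)"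
      using set_particle_law[of p t]
      by (auto simp: AE_measure_pmf_iff algebra_simps power2_eq_square)
  qed auto
  also have "\<dots> = p / (1 - p) * real t - (p / (1 - p))\<^sup>2 / 2 * (1 - (2 * p - 1) ^ t)
      + (2 * p * (p / (1 - p) / 2 * (1 - (2 * p - 1) ^ t)) + p)"
    using Suc.IH expectation_position_direction[OF assms, of t] by simp
  also have "\<dots> = p / (1 - p) * real (Suc t) - (p / (1 - p))\<^sup>2 / 2 * (1 - (2 * p - 1) ^ Suc t)"
    using assms(2) by (simp add: divide_simps power2_eq_square) (simp add: algebra_simps)
  finally show ?case .
qed

section \<open>The diffusion coefficient\<close>

lemma particle_variance:
  assumes p: "0 \<le> p" "p < 1"
    and mc: "markov_chain M particle_states particle_init (particle_step p) (\<lambda>t \<omega>. (X t \<omega>, \<Delta> t \<omega>))"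
  shows "prob_space.variance M (\<lambda>\<omega>. real_of_int (X t \<omega>)) =
    p / (1 - p) * real t - (p / (1 - p))\<^sup>2 / 2 * (1 - (2 * p - 1) ^ t)"
proof -
  have init: "set_pmf particle_init \<subseteq> particle_states"
    by (auto simp: set_particle_init particle_states_def)
  have step: "set_pmf (particle_step p z) \<subseteq> particle_states" if "z \<in> particle_states" for z
    using that set_particle_step[of p "fst z" "snd z"] by (cases z) (auto simp: particle_states_def)
  have mean: "(\<integral>\<omega>. real_of_int (X t \<omega>) \<partial>M) = 0"
    using markov_chain_expectation[OF mc init step, of "\<lambda>(x, d). real_of_int x" t]
      expectation_position[of p t] p by simp
  show ?thesis
    using markov_chain_expectation[OF mc init step, of "\<lambda>(x, d). (real_of_int x)\<^sup>2" t]
      expectation_position_square[OF p, of t] by (simp add: mean)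
qed

theorem mainTheorem2:
  fixes M :: "'a measure" and X \<Delta> :: "nat \<Rightarrow> 'a \<Rightarrow> int" and p :: real
  assumes "0 < p" and "p < 1"
    and "markov_chain M particle_states particle_init (particle_step p) (\<lambda>t \<omega>. (X t \<omega>, \<Delta> t \<omega>))"
  shows "convergent (diffusion_ratio M X) \<and> diffusion_coefficient M X = 1 / 2 * (p / (1 - p))"
proof -
  define c where "c = p / (1 - p)"
  define q where "q = 2 * p - 1"
  have "\<bar>q\<bar> < 1" using assms(1,2) by (auto simp: q_def)
  then have "(\<lambda>t. q ^ t) \<longlonglongrightarrow> 0" using LIMSEQ_power_zero[of q] by simp
  then have "(\<lambda>t. c / 2 - c\<^sup>2 / 4 * (1 - q ^ t) * inverse (real t)) \<longlonglongrightarrow> c / 2 - c\<^sup>2 / 4 * (1 - 0) * 0"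
    by (intro tendsto_diff tendsto_mult tendsto_const lim_inverse_n)
  moreover have "\<forall>\<^sub>F t in sequentially.
      c / 2 - c\<^sup>2 / 4 * (1 - q ^ t) * inverse (real t) = diffusion_ratio M X t"
    using eventually_gt_at_top[of 0]
  proof eventually_elim
    case (elim t)
    have "diffusion_ratio M X t = (c * real t - c\<^sup>2 / 2 * (1 - q ^ t)) / (2 * real t)"
      using particle_variance[OF _ assms(2,3), of t] assms(1)
      by (simp add: diffusion_ratio_def c_def q_def)
    then show ?case using elim by (simp add: field_simps)
  qed
  ultimately have "diffusion_ratio M X \<longlonglongrightarrow> 1 / 2 * c"
    by (auto dest: Lim_transform_eventually)
  then show ?thesis
    unfolding diffusion_coefficient_def c_def by (auto simp: convergent_def limI)
qed

end
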